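(* Let $\alpha>0$ be a real number. For $\epsilon\in(0,1)$ let $$X_\epsilon=\{(x,y)\in(0,1)^2 \mid xy=\epsilon^2\}.$$ The family $\{X_\epsilon\}_{\epsilon\in(0,1)}$ has a uniform $1/\alpha$-mild parametrization consisting of three charts: there exist real constants $A,B>0$, independent of $\epsilon$, such that for every $\epsilon\in(0,1)$ there are three $(A,B,1/\alpha)$-mild maps $\phi_{1,\epsilon},\phi_{2,\epsilon},\phi_{3,\epsilon}:(0,1)\to X_\epsilon$ with $$X_\epsilon=\bigcup_{i=1}^{3}\phi_{i,\epsilon}((0,1)).$$
   Context: Mild maps: a function $f\in C^\infty((0,1),\mathbb{R})$ is $(A,B,C)$-mild, with $A,B\in\mathbb{R}_{>0}$ and $C\in\mathbb{R}_{\ge0}$, if $|f^{(n)}(x)|\le BA^{n}(n!)^{C+1}$ for all $x\in(0,1)$ and all integers $n\ge 0$. A map $(0,1)\to\mathbb{R}^2$ is $(A,B,C)$-mild if both its component functions are. *)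

theory Defs
  imports "HOL-Analysis.Analysis"
begin

text \<open>
  Functions on the open unit interval are represented by total functions on the reals.
  As the interval is open, \<^term>\<open>deriv\<close> at its points depends only on the values there.
\<close>

definition smooth_on_unit :: "(real \<Rightarrow> real) \<Rightarrow> bool" where
  "smooth_on_unit f \<longleftrightarrow> (\<forall>n. (deriv ^^ n) f differentiable_on {0<..<1})"

definition mild :: "real \<Rightarrow> real \<Rightarrow> real \<Rightarrow> (real \<Rightarrow> real) \<Rightarrow> bool" where
  "mild A B C f \<longleftrightarrow>
     A > 0 \<and> B > 0 \<and> C \<ge> 0 \<and> smooth_on_unit f \<and>
     (\<forall>n. \<forall>x\<in>{0<..<1}. \<bar>(deriv ^^ n) f x\<bar> \<le> B * A ^ n * (fact n) powr (C + 1))"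

definition mild_map :: "real \<Rightarrow> real \<Rightarrow> real \<Rightarrow> (real \<Rightarrow> real \<times> real) \<Rightarrow> bool" where
  "mild_map A B C \<phi> \<longleftrightarrow> mild A B C (\<lambda>t. fst (\<phi> t)) \<and> mild A B C (\<lambda>t. snd (\<phi> t))"

definition hyperbola :: "real \<Rightarrow> (real \<times> real) set" where
  "hyperbola \<epsilon> = {(x, y). x \<in> {0<..<1} \<and> y \<in> {0<..<1} \<and> x * y = \<epsilon>\<^sup>2}"

end

theory Submission
  imports Defs "HOL-Complex_Analysis.Cauchy_Integral_Formula"
begin

text \<open>
  Put \<open>L = - ln \<epsilon>\<close>.  The point \<open>(\<epsilon>, \<epsilon>)\<close> cuts the curve into two branches that are
  exchanged by swapping the coordinates; it is covered by a constant chart, so one branch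
  \<open>\<epsilon> < x < 1\<close> has to be parametrized.  On it \<open>x\<close> is written as \<open>exp (1 - t powr (- \<alpha>))\<close>, hence
  \<open>y = exp (t powr (- \<alpha>) - 1 - 2 * L)\<close>, where \<open>t\<close> runs from \<open>a = (1 + L) powr (- 1 / \<alpha>)\<close> to \<open>1\<close>;
  the affine substitution \<open>t = a + (1 - a) * s\<close> moves the parameter to the unit interval, and
  only makes derivatives smaller.

  Let \<open>u = t powr (- \<alpha>)\<close>.  On this range \<open>u < 1 + L\<close>, so that \<open>x\<close> and \<open>y\<close> are both at most
  \<open>exp (1 - u)\<close>: the growing factor \<open>exp u\<close> in \<open>y\<close> is paid for twice over by \<open>exp (- 2 * L)\<close>.
  Both coordinates extend holomorphically to the right half plane.  There is a \<open>\<delta>\<close> depending only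
  on \<open>\<alpha>\<close> such that \<open>z powr (- \<alpha>)\<close> differs from \<open>u\<close> by at most \<open>u / 2\<close> on the disc of radius
  \<open>\<delta> * t\<close> about \<open>t\<close> (\<open>powr_relative_continuity\<close>), and so the extensions are bounded there by
  \<open>exp (1 - u / 2)\<close>.  Cauchy's inequality bounds the \<open>n\<close>-th derivative at \<open>t\<close> by
  \<open>fact n * exp (1 - u / 2) / (\<delta> * t) ^ n\<close>.  The singular factor \<open>1 / t ^ n\<close> is absorbed by
  \<open>exp (- u / 2)\<close> at the cost of \<open>fact n powr (1 / \<alpha>)\<close> and a geometric factor
  (\<open>inverse_power_exp_bound\<close>), which is exactly what mildness allows (\<open>mild_exp_powr\<close>).  As \<open>L\<close>
  has disappeared from the bound, the constants do not depend on \<open>\<epsilon>\<close>.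
\<close>

text \<open>
  This transfers Cauchy's inequality, a statement about complex derivatives, to the iterated real
  derivatives that define mildness.
\<close>

lemma higher_deriv_Re_has_derivative:
  fixes f :: "real \<Rightarrow> real" and F :: "complex \<Rightarrow> complex"
  assumes F: "F holomorphic_on S" "open S"
    and I: "open I" "complex_of_real ` I \<subseteq> S"
    and f: "\<And>x. x \<in> I \<Longrightarrow> f x = Re (F (of_real x))"
    and x: "x \<in> I"
  shows "(deriv ^^ n) f x = Re ((deriv ^^ n) F (of_real x))"
    and "((deriv ^^ n) f has_real_derivative Re ((deriv ^^ Suc n) F (of_real x))) (at x)"
proof -
  have step: "(g has_real_derivative Re ((deriv ^^ Suc n) F (of_real x))) (at x)"
    if g: "\<And>x. x \<in> I \<Longrightarrow> g x = Re ((deriv ^^ n) F (of_real x))" and x: "x \<in> I" for g n x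
  proof -
    have "((deriv ^^ n) F has_field_derivative (deriv ^^ Suc n) F (of_real x)) (at (of_real x))"
      using I x by (intro has_field_derivative_higher_deriv[OF F]) auto
    then have "((\<lambda>x. Re ((deriv ^^ n) F (of_real x)))
        has_vector_derivative Re ((deriv ^^ Suc n) F (of_real x))) (at x)"
      by (intro bounded_linear.has_vector_derivative[OF bounded_linear_Re]
            has_vector_derivative_real_field)
    then show ?thesis
      unfolding has_real_derivative_iff_has_vector_derivative
      by (rule has_vector_derivative_transform_within_open[OF _ I(1) x]) (simp add: g)
  qed
  have eq: "(deriv ^^ n) f x = Re ((deriv ^^ n) F (of_real x))" if "x \<in> I" for n x
    using that
  proof (induction n arbitrary: x)
    case 0
    then show ?case by (simp add: f)
  next
    case (Suc n)
    then show ?case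
      using DERIV_imp_deriv[OF step[of "(deriv ^^ n) f" n x]] by simp
  qed
  show "(deriv ^^ n) f x = Re ((deriv ^^ n) F (of_real x))"
    by (rule eq[OF x])
  show "((deriv ^^ n) f has_real_derivative Re ((deriv ^^ Suc n) F (of_real x))) (at x)"
    using eq x by (rule step)
qed

text \<open>
  Since \<open>powr\<close> is homogeneous, continuity at \<open>1\<close> alone gives a \<open>\<delta>\<close> that serves every \<open>t\<close> after
  scaling by \<open>t\<close>.  This keeps the discs of Cauchy's inequality proportional to the distance from
  the singularity at \<open>0\<close>.
\<close>

lemma powr_relative_continuity:
  fixes c :: real
  assumes "e > 0"
  obtains \<delta> where "0 < \<delta>" "\<delta> < 1"
    "\<And>t z. 0 < t \<Longrightarrow> norm (z - complex_of_real t) \<le> \<delta> * t \<Longrightarrow>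
       norm (z powr of_real c - of_real (t powr c)) \<le> e * t powr c"
proof -
  have "isCont (\<lambda>w. w powr complex_of_real c) 1"
    by (intro continuous_intros) auto
  then obtain d where d: "d > 0"
    "\<And>w. dist w 1 < d \<Longrightarrow> dist (w powr complex_of_real c) (1 powr complex_of_real c) < e"
    using assms unfolding continuous_at_eps_delta by blast
  define \<delta> where "\<delta> = min (d/2) (1/2)"
  have \<delta>: "0 < \<delta>" "\<delta> < 1" "\<delta> < d" using d(1) by (auto simp: \<delta>_def)
  have "norm (z powr of_real c - of_real (t powr c)) \<le> e * t powr c"
    if t: "0 < t" and z: "norm (z - complex_of_real t) \<le> \<delta> * t" for t z
  proof -
    define w where "w = z / of_real t"
    have zw: "z = of_real t * w" using t by (simp add: w_def)
    have "z - of_real t = of_real t * (w - 1)" by (simp add: zw algebra_simps)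
    then have "norm (z - of_real t) = t * norm (w - 1)" using t by (simp add: norm_mult)
    with z t have "norm (w - 1) \<le> \<delta>" by (simp add: mult.commute)
    with \<delta> have "dist w 1 < d" by (simp add: dist_norm)
    then have w: "norm (w powr of_real c - 1) \<le> e" using d(2)[of w] by (simp add: dist_norm)
    have "z powr of_real c = of_real t powr of_real c * w powr of_real c"
      unfolding zw using t by (intro powr_times_real_left) auto
    also have "of_real t powr of_real c = complex_of_real (t powr c)"
      using t by (simp add: powr_of_real)
    finally have "z powr of_real c - of_real (t powr c) = of_real (t powr c) * (w powr of_real c - 1)"
      by (simp add: algebra_simps)
    then have "norm (z powr of_real c - of_real (t powr c)) = t powr c * norm (w powr of_real c - 1)"
      by (simp add: norm_mult)
    also have "\<dots> \<le> t powr c * e" using w by (intro mult_left_mono) auto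
    finally show ?thesis by (simp add: mult.commute)
  qed
  with \<delta> show thesis by (intro that[of \<delta>]) auto
qed

text \<open>
  With \<open>u = t powr (- \<alpha>)\<close> the left-hand side is the \<open>1 / \<alpha>\<close>-th power of
  \<open>u ^ n * exp (- (\<alpha> / 2 * u))\<close>, which is bounded by comparing \<open>exp (\<alpha> / 2 * u)\<close> with the
  \<open>n\<close>-th term of its power series.  The exponent \<open>1 / \<alpha>\<close> of mildness originates here.
\<close>

lemma inverse_power_exp_bound:
  fixes \<alpha> t :: real
  assumes "\<alpha> > 0" "t > 0"
  shows "exp (- (t powr (- \<alpha>)) / 2) / t ^ n \<le> ((2 / \<alpha>) powr (1 / \<alpha>)) ^ n * fact n powr (1 / \<alpha>)"
proof -
  define u where "u = t powr (- \<alpha>)"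
  have u: "u > 0" using assms by (simp add: u_def)
  have "(\<alpha> / 2 * u) ^ n /\<^sub>R fact n \<le> exp (\<alpha> / 2 * u)"
    unfolding exp_def using assms u
      sum_le_suminf[OF summable_exp_generic[of "\<alpha> / 2 * u"], of "{n}"] by simp
  then have "u ^ n * exp (- (\<alpha> / 2 * u)) \<le> (2 / \<alpha>) ^ n * fact n"
    using assms by (simp add: exp_minus field_simps power_mult_distrib power_divide)
  then have "(u ^ n * exp (- (\<alpha> / 2 * u))) powr (1 / \<alpha>) \<le> ((2 / \<alpha>) ^ n * fact n) powr (1 / \<alpha>)"
    using assms u by (intro powr_mono2) auto
  also have "((2 / \<alpha>) ^ n * fact n) powr (1 / \<alpha>) = ((2 / \<alpha>) powr (1 / \<alpha>)) ^ n * fact n powr (1 / \<alpha>)"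
    using assms by (simp add: powr_mult powr_power powr_realpow[symmetric] powr_powr mult.commute)
  also have "(u ^ n * exp (- (\<alpha> / 2 * u))) powr (1 / \<alpha>) = exp (- u / 2) / t ^ n"
  proof -
    have "(u ^ n) powr (1 / \<alpha>) = t powr (- real n)"
      using assms by (simp add: u_def powr_realpow[symmetric] powr_powr)
    also have "\<dots> = 1 / t ^ n" using assms by (simp add: powr_minus powr_realpow field_simps)
    finally show ?thesis
      using assms u by (simp add: powr_mult exp_powr_real)
  qed
  finally show ?thesis by (simp add: u_def)
qed

text \<open>
  The two coordinates of a branch are the cases \<open>\<sigma> = - 1\<close> and \<open>\<sigma> = 1\<close>.  All that matters about
  the additive constant \<open>d\<close> is that the exponent stays below \<open>1 - u\<close>, where
  \<open>u = (a + (1 - a) * s) powr (- \<alpha>)\<close>: passing to a complex disc costs at most \<open>u / 2\<close>, and the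
  remaining \<open>exp (- u / 2)\<close> compensates the shrinking radius of the disc.  The resulting bound is
  independent of \<open>a\<close> and \<open>d\<close>.
\<close>

lemma mild_exp_powr:
  fixes \<alpha> \<delta> a \<sigma> d :: real and f :: "real \<Rightarrow> real"
  assumes \<alpha>: "\<alpha> > 0" and \<delta>: "0 < \<delta>" "\<delta> < 1"
    and near: "\<And>t z. 0 < t \<Longrightarrow> norm (z - complex_of_real t) \<le> \<delta> * t \<Longrightarrow>
       norm (z powr of_real (- \<alpha>) - of_real (t powr (- \<alpha>))) \<le> 1 / 2 * t powr (- \<alpha>)"
    and a: "0 < a" "a < 1" and \<sigma>: "\<bar>\<sigma>\<bar> \<le> 1"
    and f: "\<And>s. s \<in> {0<..<1} \<Longrightarrow> f s = exp (\<sigma> * (a + (1 - a) * s) powr (- \<alpha>) + d)"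
    and le: "\<And>s. s \<in> {0<..<1} \<Longrightarrow>
       \<sigma> * (a + (1 - a) * s) powr (- \<alpha>) + d \<le> 1 - (a + (1 - a) * s) powr (- \<alpha>)"
  shows "mild ((2 / \<alpha>) powr (1 / \<alpha>) / \<delta>) (exp 1) (1 / \<alpha>) f"
proof -
  define A where "A = (2 / \<alpha>) powr (1 / \<alpha>) / \<delta>"
  have A: "A > 0" using \<alpha> \<delta> by (simp add: A_def)
  define T :: "complex \<Rightarrow> complex" where "T = (\<lambda>z. of_real a + of_real (1 - a) * z)"
  define F where "F = (\<lambda>z. exp (of_real \<sigma> * T z powr of_real (- \<alpha>) + of_real d))"
  define S where "S = {z. Re (T z) > 0}"
  have S: "open S" unfolding S_def T_def by (intro open_Collect_less continuous_intros)
  have F: "F holomorphic_on S"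
    unfolding F_def T_def by (intro holomorphic_intros) (auto simp: S_def T_def complex_nonpos_Reals_iff)
  have T_real: "T (of_real s) = of_real (a + (1 - a) * s)" for s by (simp add: T_def)
  have pos: "a + (1 - a) * s > 0" if "s \<in> {0<..<1}" for s
    using a that by (intro add_pos_pos mult_pos_pos) auto
  have sub: "complex_of_real ` {0<..<1} \<subseteq> S"
    using pos by (auto simp: S_def T_real simp del: of_real_add of_real_mult of_real_diff)
  have fF: "f s = Re (F (of_real s))" if "s \<in> {0<..<1}" for s
  proof -
    have "F (of_real s) = of_real (f s)"
      using pos[OF that] f[OF that]
      by (simp add: F_def T_real powr_of_real exp_of_real[symmetric]
            del: of_real_minus of_real_add of_real_mult of_real_diff)
         simp
    then show ?thesis by simp
  qed
  note derivs = higher_deriv_Re_has_derivative[OF F S open_greaterThanLessThan sub fF]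
  have "smooth_on_unit f"
    unfolding smooth_on_unit_def
    using derivs(2) by (meson differentiable_at_withinI differentiable_on_def real_differentiable_def)
  moreover have "\<bar>(deriv ^^ n) f s\<bar> \<le> exp 1 * A ^ n * fact n powr (1 / \<alpha> + 1)"
    if s: "s \<in> {0<..<1}" for n s
  proof -
    define t where "t = a + (1 - a) * s"
    have t: "t > 0" using pos[OF s] by (simp add: t_def)
    define u where "u = t powr (- \<alpha>)"
    \<comment> \<open>The affine map \<open>T\<close> contracts, so the radius \<open>\<delta> * t\<close> also works around \<open>s\<close>.\<close>
    have disc: "norm (T z - of_real t) \<le> \<delta> * t" if "norm (of_real s - z) \<le> \<delta> * t" for z
    proof -
      have "T z - of_real t = of_real (1 - a) * (z - of_real s)"
        by (simp add: T_def t_def algebra_simps)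
      then have "norm (T z - of_real t) = (1 - a) * norm (of_real s - z)"
        using a by (simp add: norm_mult norm_minus_commute del: of_real_diff)
      also have "\<dots> \<le> 1 * norm (of_real s - z)"
        using a by (intro mult_right_mono) auto
      finally show ?thesis using that by simp
    qed
    have "cball (of_real s) (\<delta> * t) \<subseteq> S"
    proof
      fix z assume "z \<in> cball (complex_of_real s) (\<delta> * t)"
      then have "norm (T z - of_real t) \<le> \<delta> * t" by (intro disc) (simp add: dist_norm)
      moreover have "\<delta> * t < t" using \<delta> t by simp
      ultimately have "\<bar>Re (T z - of_real t)\<bar> < t"
        using abs_Re_le_cmod[of "T z - of_real t"] by linarith
      then show "z \<in> S" by (simp add: S_def)
    qed
    then have hol: "F holomorphic_on cball (of_real s) (\<delta> * t)"
      using F holomorphic_on_subset by blast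
    have "norm ((deriv ^^ n) F (of_real s)) \<le> fact n * exp (1 - u / 2) / (\<delta> * t) ^ n"
    proof (rule Cauchy_inequality)
      show "F holomorphic_on ball (of_real s) (\<delta> * t)"
        using hol ball_subset_cball holomorphic_on_subset by blast
      show "continuous_on (cball (of_real s) (\<delta> * t)) F"
        using hol by (rule holomorphic_on_imp_continuous_on)
      show "0 < \<delta> * t" using \<delta> t by simp
      fix z :: complex assume z: "norm (of_real s - z) = \<delta> * t"
      define w where "w = T z powr of_real (- \<alpha>)"
      have w: "norm (w - of_real u) \<le> u / 2"
        using near[OF t disc] z by (simp add: w_def u_def)
      have "Re (of_real \<sigma> * (w - of_real u)) \<le> norm (of_real \<sigma> * (w - of_real u))"
        by (rule complex_Re_le_cmod)
      also have "\<dots> \<le> 1 * norm (w - of_real u)"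
        unfolding norm_mult using \<sigma> by (intro mult_right_mono) auto
      finally have "\<sigma> * Re w \<le> \<sigma> * u + u / 2"
        using w by (simp add: algebra_simps)
      moreover have "\<sigma> * u + d \<le> 1 - u" using le[OF s] by (simp add: u_def t_def)
      ultimately have "\<sigma> * Re w + d \<le> 1 - u / 2" by simp
      then show "norm (F z) \<le> exp (1 - u / 2)" by (simp add: F_def w_def)
    qed
    also have "\<dots> = fact n * exp 1 / \<delta> ^ n * (exp (- u / 2) / t ^ n)"
    proof -
      have "exp (1 - u / 2) = exp 1 * exp (- u / 2)" by (simp flip: exp_add)
      then show ?thesis by (simp add: power_mult_distrib)
    qed
    also have "\<dots> \<le> fact n * exp 1 / \<delta> ^ n * (((2 / \<alpha>) powr (1 / \<alpha>)) ^ n * fact n powr (1 / \<alpha>))"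
      unfolding u_def using \<delta> by (intro mult_left_mono inverse_power_exp_bound \<alpha> t) auto
    also have "\<dots> = exp 1 * A ^ n * fact n powr (1 / \<alpha> + 1)"
      by (simp add: A_def power_divide powr_add)
    finally show ?thesis
      using derivs(1)[OF _ s, of n] abs_Re_le_cmod[of "(deriv ^^ n) F (of_real s)"] by simp
  qed
  ultimately show ?thesis using A \<alpha> unfolding mild_def A_def by simp
qed

lemma mild_const:
  assumes "A > 0" "B > 0" "C \<ge> 0" "\<bar>c\<bar> \<le> B"
  shows "mild A B C (\<lambda>_. c)"
proof -
  have "(deriv ^^ n) (\<lambda>_. c) = (\<lambda>_. if n = 0 then c else 0)" for n
    by (induction n) auto
  then show ?thesis
    using assms by (auto simp: mild_def smooth_on_unit_def)
qed

theorem mainTheorem4: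
  fixes \<alpha> :: real
  assumes "\<alpha> > 0"
  shows "\<exists>A B :: real. A > 0 \<and> B > 0 \<and>
    (\<forall>\<epsilon>\<in>{0<..<1}. \<exists>\<phi> :: nat \<Rightarrow> real \<Rightarrow> real \<times> real.
       (\<forall>i\<in>{1..3}. mild_map A B (1 / \<alpha>) (\<phi> i) \<and> \<phi> i \<in> {0<..<1} \<rightarrow> hyperbola \<epsilon>) \<and>
       hyperbola \<epsilon> = (\<Union>i\<in>{1..3}. \<phi> i ` {0<..<1}))"
proof -
  obtain \<delta> where \<delta>: "0 < \<delta>" "\<delta> < 1"
    and near: "\<And>t z. 0 < t \<Longrightarrow> norm (z - complex_of_real t) \<le> \<delta> * t \<Longrightarrow>
       norm (z powr of_real (- \<alpha>) - of_real (t powr (- \<alpha>))) \<le> 1 / 2 * t powr (- \<alpha>)"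
    using powr_relative_continuity[of "1/2" "- \<alpha>"] by auto
  define A where "A = (2 / \<alpha>) powr (1 / \<alpha>) / \<delta>"
  have A: "A > 0" using assms \<delta> by (simp add: A_def)
  note mild = mild_exp_powr[OF assms \<delta> near, folded A_def]
  have "\<exists>\<phi> :: nat \<Rightarrow> real \<Rightarrow> real \<times> real.
       (\<forall>i\<in>{1..3}. mild_map A (exp 1) (1 / \<alpha>) (\<phi> i) \<and> \<phi> i \<in> {0<..<1} \<rightarrow> hyperbola \<epsilon>) \<and>
       hyperbola \<epsilon> = (\<Union>i\<in>{1..3}. \<phi> i ` {0<..<1})"
    if \<epsilon>: "\<epsilon> \<in> {0<..<1}" for \<epsilon>
  proof -
    define L where "L = - ln \<epsilon>"
    have L: "L > 0" "\<epsilon> = exp (- L)" using \<epsilon> by (auto simp: L_def)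
    define a where "a = (1 + L) powr (- 1 / \<alpha>)"
    have a: "0 < a" "a < 1"
      using L assms by (auto simp: a_def powr_less_one)
    have a_pow: "a powr (- \<alpha>) = 1 + L"
      using L assms by (simp add: a_def powr_powr)
    define u where "u = (\<lambda>s. (a + (1 - a) * s) powr (- \<alpha>))"
    have u: "1 < u s" "u s < 1 + L" if s: "s \<in> {0<..<1}" for s
    proof -
      have "(1 - a) * s > 0" using a s by simp
      moreover have "(1 - a) * s < (1 - a) * 1" using a s by (intro mult_strict_left_mono) auto
      ultimately have t: "a < a + (1 - a) * s" "a + (1 - a) * s < 1" by auto
      show "1 < u s"
        using powr_less_mono2_neg[of "- \<alpha>" "a + (1 - a) * s" 1] t a assms by (simp add: u_def)
      show "u s < 1 + L"
        using powr_less_mono2_neg[of "- \<alpha>" a "a + (1 - a) * s"] t a assms a_pow by (simp add: u_def)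
    qed
    have u_surj: "\<exists>s\<in>{0<..<1}. u s = v" if v: "1 < v" "v < 1 + L" for v
    proof -
      define t where "t = v powr (- 1 / \<alpha>)"
      have t: "a < t" "t < 1"
        using v assms powr_less_mono2_neg[of "- 1 / \<alpha>" v "1 + L"]
        by (auto simp: t_def a_def powr_less_one)
      have "t powr (- \<alpha>) = v" using v assms by (simp add: t_def powr_powr)
      then show ?thesis
        using t a by (intro bexI[of _ "(t - a) / (1 - a)"]) (auto simp: u_def)
    qed
    define f where "f = (\<lambda>s. exp (1 - u s))"
    define g where "g = (\<lambda>s. exp (u s - 1 - 2 * L))"
    define \<phi> :: "nat \<Rightarrow> real \<Rightarrow> real \<times> real"
      where "\<phi> i s = (if i = 1 then (f s, g s) else if i = 2 then (g s, f s) else (\<epsilon>, \<epsilon>))" for i s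
    have mf: "mild A (exp 1) (1 / \<alpha>) f"
      using a by (intro mild[where a = a and \<sigma> = "-1" and d = 1]) (auto simp: f_def u_def)
    \<comment> \<open>Here \<open>u s - 1 - 2 * L \<le> 1 - u s\<close> is just \<open>u s \<le> 1 + L\<close>.\<close>
    have mg: "mild A (exp 1) (1 / \<alpha>) g"
      using a u by (intro mild[where a = a and \<sigma> = 1 and d = "- 1 - 2 * L"])
        (fastforce simp: g_def u_def algebra_simps)+
    have mc: "mild A (exp 1) (1 / \<alpha>) (\<lambda>_. \<epsilon>)"
      using A assms \<epsilon> exp_ge_add_one_self[of 1] by (intro mild_const) auto
    have fg: "f s * g s = \<epsilon>\<^sup>2" for s
      by (simp add: f_def g_def L(2) exp_add[symmetric] power2_eq_square)
    have rng: "f s \<in> {0<..<1}" "g s \<in> {0<..<1}" if "s \<in> {0<..<1}" for s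
      using u[OF that] L by (auto simp: f_def g_def)
    have i3: "{1..3::nat} = {1, 2, 3}" by auto
    have "\<forall>i\<in>{1..3}. mild_map A (exp 1) (1 / \<alpha>) (\<phi> i)"
      unfolding i3 using mf mg mc by (simp add: \<phi>_def mild_map_def)
    moreover have "\<forall>i\<in>{1..3}. \<phi> i \<in> {0<..<1} \<rightarrow> hyperbola \<epsilon>"
      unfolding i3 using fg rng \<epsilon>
      by (simp add: \<phi>_def hyperbola_def Pi_iff mult.commute[of "g _"] power2_eq_square)
    moreover have "hyperbola \<epsilon> \<subseteq> (\<Union>i\<in>{1..3}. \<phi> i ` {0<..<1})"
    proof (rule subrelI)
      fix x y assume "(x, y) \<in> hyperbola \<epsilon>"
      then have x: "0 < x" "x < 1" and y: "0 < y" "y < 1" and prod: "x * y = \<epsilon>\<^sup>2"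
        by (auto simp: hyperbola_def)
      have half: "\<exists>s\<in>{0<..<1}. (p, q) = (f s, g s)"
        if p: "0 < p" "p < 1" "\<epsilon> < p" and pq: "p * q = \<epsilon>\<^sup>2" for p q
      proof -
        have "ln \<epsilon> < ln p" using p \<epsilon> by simp
        then obtain s where s: "s \<in> {0<..<1}" "u s = 1 - ln p"
          using u_surj[of "1 - ln p"] p by (auto simp: L_def)
        then have "f s = p" using p by (simp add: f_def)
        moreover have "g s = q" using fg[of s] pq p \<open>f s = p\<close> by (metis less_irrefl mult_left_cancel)
        ultimately show ?thesis using s by blast
      qed
      consider "\<epsilon> < x" | "\<epsilon> < y" | "x \<le> \<epsilon>" "y \<le> \<epsilon>" by linarith
      then show "(x, y) \<in> (\<Union>i\<in>{1..3}. \<phi> i ` {0<..<1})"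
      proof cases
        case 1
        then show ?thesis unfolding i3 using half[of x y] x prod by (auto simp: \<phi>_def)
      next
        case 2
        then show ?thesis unfolding i3 using half[of y x] y prod by (auto simp: \<phi>_def mult.commute)
      next
        case 3
        have "x * y \<le> x * \<epsilon>" "x * y \<le> \<epsilon> * y" using 3 x y by (auto intro: mult_left_mono mult_right_mono)
        then have "\<epsilon> \<le> x" "\<epsilon> \<le> y" using prod \<epsilon> by (auto simp: power2_eq_square)
        with 3 have "\<phi> 3 (1 / 2) = (x, y)" by (simp add: \<phi>_def)
        then have "(x, y) \<in> \<phi> 3 ` {0<..<1}" by (intro image_eqI[of _ _ "1 / 2"]) auto
        then show ?thesis unfolding i3 by blast
      qed
    qed
    ultimately show ?thesis by (intro exI[of _ \<phi>]) blast
  qed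
  with A show ?thesis by (intro exI[of _ A] exI[of _ "exp 1"]) simp
qed

end
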